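(* (a) Let $G$ be a balanced rectangular fabric graph built from strands $S_1,\dots,S_m$, and let $A_i$ be the bi-adjacency matrix of $S_i$ ($i=1,\dots,m$). Then $$\mathrm{M}(G)=\det(A_1A_2\cdots A_m).$$ (b) Let $G$ be a cylindrical fabric graph built from strands $S_1,\dots,S_m$, where $S_i$ has $l_{i-1}$ bottom vertices and $l_i$ top vertices ($i=1,\dots,m$, with $l_0:=l_m$), the vertical edges joining $S_i$ to $S_{i+1}$ having weight $x_i$ ($S_{m+1}:=S_1$), and let $A_i$ be the bi-adjacency matrix of $S_i$. Then $$\mathrm{M}(G;x_1,\dots,x_m)=x_1^{l_1-l_m}\cdots x_{m-1}^{l_{m-1}-l_m}\det\big((x_1\cdots x_m)I+A_1A_2\cdots A_m\big),$$ where $I$ is the identity matrix of order $l_m$.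
   Context: A strand is a weighted bipartite graph which is a path with pendant edges attached, drawn in the plane without edge crossings so that its white vertices $u_1,\dots,u_k$ lie from left to right on a horizontal line (the bottom vertices) and its black vertices $v_1,\dots,v_l$ lie from left to right on a parallel horizontal line above it (the top vertices), every edge being a straight segment joining a bottom vertex to a top vertex. Edge weights are arbitrary (possibly zero). The bi-adjacency matrix of a strand is the $k\times l$ matrix whose $(p,q)$ entry is the weight of the edge $\{u_p,v_q\}$ if it exists and $0$ otherwise. A rectangular fabric graph: take strands $S_1,\dots,S_m$, $S_i$ having $k_i$ bottom and $l_i$ top vertices, with $l_i=k_{i+1}$ for $i=1,\dots,m-1$; draw them one above the other with $S_1$ at the bottom, and join the $j$-th top vertex of $S_i$ to the $j$-th bottom vertex of $S_{i+1}$ by a (vertical) edge of weight $1$, for all $j$ and $i=1,\dots,m-1$. It is balanced if $k_1=l_m$ (equal numbers of white and black vertices). A cylindrical fabric graph: take strands $S_1,\dots,S_m$ with $l_i=k_{i+1}$ for $i=1,\dots,m$ where $k_{m+1}:=k_1$; join the $j$-th top vertex of $S_i$ to the $j$-th bottom vertex of $S_{i+1}$ for $i=1,\dots,m$ (with $S_{m+1}:=S_1$), these vertical edges between $S_i$ and $S_{i+1}$ all having weight $x_i$. For a weighted graph $G$, $\mathrm{M}(G)$ denotes the sum over all perfect matchings of $G$ of the product of the weights of the edges in the matching; for a cylindrical fabric graph this is written $\mathrm{M}(G;x_1,\dots,x_m)$ and regarded as a function of the vertical weights $x_i$. *)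

theory Defs
  imports "HOL-Analysis.Line_Segment" "Jordan_Normal_Form.Determinant"
begin

(* Edges are labels with a set of ends, so that parallel edges are allowed: a cylindrical fabric
   graph on a single strand may have a strand edge and a vertical edge with the same ends. *)
record ('v, 'e, 'a) weighted_graph =
  verts :: "'v set"
  arcs :: "'e set"
  ends :: "'e \<Rightarrow> 'v set"
  weight :: "'e \<Rightarrow> 'a"

definition perfect_matchings :: "('v, 'e, 'a) weighted_graph \<Rightarrow> 'e set set" where
  "perfect_matchings G = {F. F \<subseteq> arcs G \<and> (\<forall>v\<in>verts G. \<exists>!e. e \<in> F \<and> v \<in> ends G e)}"

definition matching_sum :: "('v, 'e, 'a::comm_semiring_1) weighted_graph \<Rightarrow> 'a" where
  "matching_sum G = (\<Sum>F\<in>perfect_matchings G. \<Prod>e\<in>F. weight G e)"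

definition path_with_pendant_edges :: "'v set \<Rightarrow> 'v set set \<Rightarrow> bool" where
  "path_with_pendant_edges V E \<longleftrightarrow>
     (\<exists>P att. P \<noteq> [] \<and> distinct P \<and> set P \<subseteq> V \<and> (\<forall>v\<in>V - set P. att v \<in> set P) \<and>
        E = {{P ! i, P ! Suc i} | i. Suc i < length P} \<union> {{v, att v} | v. v \<in> V - set P})"

(* Bottom p and Top q stand for the vertices u_(p+1) and v_(q+1) of a strand: positions inside a
   strand are counted from 0, in accordance with the matrix indices. *)
datatype strand_vertex = Bottom nat | Top nat

(* The pair (p, q) in segs encodes the edge joining Bottom p to Top q. *)
record 'a strand =
  bottoms :: nat
  tops :: nat
  segs :: "(nat \<times> nat) set"
  seg_weight :: "nat \<times> nat \<Rightarrow> 'a"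

definition strand_verts :: "('a, 'b) strand_scheme \<Rightarrow> strand_vertex set" where
  "strand_verts S = Bottom ` {..<bottoms S} \<union> Top ` {..<tops S}"

(* The bottom vertices are placed at the points (a p, c), the top ones at (b q, d).  As a and b are
   increasing and c < d, a segment contains no vertex except its ends, so there is no
   crossing iff the open segments are disjoint. *)
definition noncrossing_drawable :: "nat \<Rightarrow> nat \<Rightarrow> (nat \<times> nat) set \<Rightarrow> bool" where
  "noncrossing_drawable k l E \<longleftrightarrow>
     (\<exists>(a :: nat \<Rightarrow> real) (b :: nat \<Rightarrow> real) (c :: real) (d :: real).
        strict_mono_on {..<k} a \<and> strict_mono_on {..<l} b \<and> c < d \<and>
        (\<forall>(p, q)\<in>E. \<forall>(p', q')\<in>E. (p, q) \<noteq> (p', q') \<longrightarrow>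
           open_segment (a p, c) (b q, d) \<inter> open_segment (a p', c) (b q', d) = {}))"

definition is_strand :: "('a, 'b) strand_scheme \<Rightarrow> bool" where
  "is_strand S \<longleftrightarrow>
     segs S \<subseteq> {..<bottoms S} \<times> {..<tops S} \<and>
     path_with_pendant_edges (strand_verts S) ((\<lambda>(p, q). {Bottom p, Top q}) ` segs S) \<and>
     noncrossing_drawable (bottoms S) (tops S) (segs S)"

definition biadjacency :: "('a::zero, 'b) strand_scheme \<Rightarrow> 'a mat" where
  "biadjacency S = mat (bottoms S) (tops S) (\<lambda>e. if e \<in> segs S then seg_weight S e else 0)"

(* Strands are indexed by 1, ..., m, and (i, v) is the vertex v of the i-th strand.
   Vertical i j is the edge from the vertex Top j of the i-th strand to Bottom j of the next one. *)
datatype fabric_edge = Segment nat "nat \<times> nat" | Vertical nat nat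

fun fabric_ends :: "(nat \<Rightarrow> nat) \<Rightarrow> fabric_edge \<Rightarrow> (nat \<times> strand_vertex) set" where
  "fabric_ends nxt (Segment i e) = {(i, Bottom (fst e)), (i, Top (snd e))}"
| "fabric_ends nxt (Vertical i j) = {(i, Top j), (nxt i, Bottom j)}"

fun fabric_weight :: "(nat \<Rightarrow> 'a strand) \<Rightarrow> (nat \<Rightarrow> 'a) \<Rightarrow> fabric_edge \<Rightarrow> 'a" where
  "fabric_weight S x (Segment i e) = seg_weight (S i) e"
| "fabric_weight S x (Vertical i j) = x i"

definition rectangular_strands :: "nat \<Rightarrow> (nat \<Rightarrow> 'a strand) \<Rightarrow> bool" where
  "rectangular_strands m S \<longleftrightarrow> 1 \<le> m \<and> (\<forall>i\<in>{1..m}. is_strand (S i)) \<and>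
     (\<forall>i\<in>{1..<m}. tops (S i) = bottoms (S (Suc i)))"

definition rectangular_fabric ::
    "nat \<Rightarrow> (nat \<Rightarrow> 'a::one strand) \<Rightarrow> (nat \<times> strand_vertex, fabric_edge, 'a) weighted_graph" where
  "rectangular_fabric m S =
     \<lparr>verts = (SIGMA i:{1..m}. strand_verts (S i)),
      arcs = {Segment i e | i e. i \<in> {1..m} \<and> e \<in> segs (S i)} \<union>
             {Vertical i j | i j. i \<in> {1..<m} \<and> j < tops (S i)},
      ends = fabric_ends Suc,
      weight = fabric_weight S (\<lambda>i. 1)\<rparr>"

definition balanced :: "nat \<Rightarrow> (nat \<Rightarrow> 'a strand) \<Rightarrow> bool" where
  "balanced m S \<longleftrightarrow> bottoms (S 1) = tops (S m)"

definition cyclic_next :: "nat \<Rightarrow> nat \<Rightarrow> nat" where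
  "cyclic_next m i = (if i = m then 1 else Suc i)"

definition cylindrical_strands :: "nat \<Rightarrow> (nat \<Rightarrow> 'a strand) \<Rightarrow> bool" where
  "cylindrical_strands m S \<longleftrightarrow> 1 \<le> m \<and> (\<forall>i\<in>{1..m}. is_strand (S i)) \<and>
     (\<forall>i\<in>{1..m}. tops (S i) = bottoms (S (cyclic_next m i)))"

definition cylindrical_fabric ::
    "nat \<Rightarrow> (nat \<Rightarrow> 'a strand) \<Rightarrow> (nat \<Rightarrow> 'a) \<Rightarrow>
       (nat \<times> strand_vertex, fabric_edge, 'a) weighted_graph" where
  "cylindrical_fabric m S x =
     \<lparr>verts = (SIGMA i:{1..m}. strand_verts (S i)),
      arcs = {Segment i e | i e. i \<in> {1..m} \<and> e \<in> segs (S i)} \<union>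
             {Vertical i j | i j. i \<in> {1..m} \<and> j < tops (S i)},
      ends = fabric_ends (cyclic_next m),
      weight = fabric_weight S x\<rparr>"

(* A_1 A_2 ... A_m, associated to the right; matrices of varying dimensions do not form a monoid,
   so the unit of the empty product has to be given its order, which is the number of columns
   of A_m. *)
definition biadjacency_product :: "nat \<Rightarrow> (nat \<Rightarrow> 'a::semiring_1 strand) \<Rightarrow> 'a mat" where
  "biadjacency_product m S =
     foldr (\<lambda>i B. biadjacency (S i) * B) [1..<Suc m] (1\<^sub>m (tops (S m)))"

end

theory Submission
  imports Defs
begin

text \<open>Expanding \<open>det (X I + A\<^sub>1 \<cdots> A\<^sub>m)\<close> gives the sum over \<open>J\<close> of \<open>X\<close> to the power \<open>n - |J|\<close> times the
  principal minor of the product at \<open>J\<close>. Multilinearity in the rows writes that minor as a signed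
  sum over families of vertex-disjoint paths which start at \<open>J\<close>, use one segment of each strand and
  end at \<open>J\<close>. Segments of a strand do not cross, so the paths keep their order and the sign is always
  \<open>1\<close>. Such closed families are the perfect matchings of the cylinder: the segments used determine the
  vertical edges, which cover the vertices that are left. All strands contribute \<open>|J|\<close> segments,
  hence the powers of the \<open>x\<^sub>i\<close>. A balanced rectangular fabric is a cylinder with vertical weights
  \<open>1, \<dots>, 1, 0\<close>.\<close>

section \<open>Determinants\<close>

text \<open>For \<open>f = id\<close> the determinant is the principal minor of \<open>B\<close> at \<open>J\<close>.\<close>

definition partial_rows :: "nat \<Rightarrow> nat set \<Rightarrow> (nat \<Rightarrow> nat) \<Rightarrow> 'a::zero_neq_one mat \<Rightarrow> 'a mat" where
  "partial_rows n J f B =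
     mat n n (\<lambda>(i, j). if i \<in> J then B $$ (f i, j) else if i = j then 1 else 0)"

lemma partial_rows_carrier [simp]: "partial_rows n J f B \<in> carrier_mat n n"
  by (simp add: partial_rows_def)

text \<open>The Leibniz formula with the unit rows kept as 0/1 factors: only permutations that fix
  every point outside \<open>J\<close> contribute. Summing over all permutations of
  \<open>{0..<n}\<close> spares a renumbering of \<open>J\<close>, and \<open>J\<close> may vary
  while the order \<open>n\<close> stays fixed.\<close>

lemma det_partial_rows:
  fixes B :: "'a::comm_ring_1 mat"
  assumes "J \<subseteq> {..<n}"
  shows "det (partial_rows n J f B) =
    (\<Sum>p | p permutes {0..<n}. signof p *
       ((\<Prod>i\<in>J. B $$ (f i, p i)) * (\<Prod>i\<in>{0..<n} - J. if i = p i then 1 else 0)))"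
proof -
  have "(\<Prod>i = 0..<n. partial_rows n J f B $$ (i, p i)) =
      (\<Prod>i\<in>J. B $$ (f i, p i)) * (\<Prod>i\<in>{0..<n} - J. if i = p i then 1 else 0)"
    if p: "p permutes {0..<n}" for p
  proof -
    have J: "J \<subseteq> {0..<n}" using assms by auto
    have pn: "p i < n" if "i < n" for i
      using permutes_in_image[OF p, of i] that by simp
    have "(\<Prod>i = 0..<n. partial_rows n J f B $$ (i, p i)) =
        (\<Prod>i\<in>{0..<n} - J. partial_rows n J f B $$ (i, p i)) *
        (\<Prod>i\<in>J. partial_rows n J f B $$ (i, p i))"
      by (rule prod.subset_diff[OF J]) simp
    also have "(\<Prod>i\<in>J. partial_rows n J f B $$ (i, p i)) = (\<Prod>i\<in>J. B $$ (f i, p i))"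
      using assms pn by (intro prod.cong) (auto simp: partial_rows_def)
    also have "(\<Prod>i\<in>{0..<n} - J. partial_rows n J f B $$ (i, p i)) =
        (\<Prod>i\<in>{0..<n} - J. if i = p i then 1 else 0)"
      using pn by (intro prod.cong) (auto simp: partial_rows_def)
    finally show ?thesis by (simp add: mult.commute)
  qed
  then show ?thesis
    by (subst det_def'[OF partial_rows_carrier]) (auto intro!: sum.cong)
qed

text \<open>In each factor of a Leibniz term either the entry of \<open>A\<close> or the diagonal
  entry \<open>X\<close> is chosen; \<open>J\<close> is the set of rows where \<open>A\<close> is
  chosen. This is the expansion of the characteristic polynomial in principal minors, up to
  signs.\<close>

lemma det_smult_one_add:
  fixes A :: "'a::comm_ring_1 mat"
  assumes A: "A \<in> carrier_mat n n"
  shows "det (X \<cdot>\<^sub>m 1\<^sub>m n + A) =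
    (\<Sum>J\<in>Pow {..<n}. X ^ (n - card J) * det (partial_rows n J id A))"
proof -
  have expand: "(\<Prod>i = 0..<n. (X \<cdot>\<^sub>m 1\<^sub>m n + A) $$ (i, p i)) =
      (\<Sum>J\<in>Pow {..<n}. X ^ (n - card J) *
        ((\<Prod>i\<in>J. A $$ (id i, p i)) * (\<Prod>i\<in>{0..<n} - J. if i = p i then 1 else 0)))"
    if p: "p permutes {0..<n}" for p
  proof -
    have pn: "p i < n" if "i < n" for i
      using permutes_in_image[OF p, of i] that by simp
    have "(\<Prod>i = 0..<n. (X \<cdot>\<^sub>m 1\<^sub>m n + A) $$ (i, p i)) =
        (\<Prod>i = 0..<n. A $$ (i, p i) + X * (if i = p i then 1 else 0))"
      using A pn by (intro prod.cong) auto
    also have "\<dots> = (\<Sum>J\<in>Pow {0..<n}. (\<Prod>i\<in>J. A $$ (i, p i)) *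
        (\<Prod>i\<in>{0..<n} - J. X * (if i = p i then 1 else 0)))"
      by (rule prod_add) simp
    also have "\<dots> = (\<Sum>J\<in>Pow {..<n}. X ^ (n - card J) *
        ((\<Prod>i\<in>J. A $$ (id i, p i)) * (\<Prod>i\<in>{0..<n} - J. if i = p i then 1 else 0)))"
    proof (intro sum.cong)
      fix J assume "J \<in> Pow {..<n}"
      then have "card ({0..<n} - J) = n - card J"
        by (subst card_Diff_subset) (auto intro: finite_subset[of J "{..<n}"])
      then show "(\<Prod>i\<in>J. A $$ (i, p i)) * (\<Prod>i\<in>{0..<n} - J. X * (if i = p i then 1 else 0)) =
          X ^ (n - card J) *
          ((\<Prod>i\<in>J. A $$ (id i, p i)) * (\<Prod>i\<in>{0..<n} - J. if i = p i then 1 else 0))"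
        by (subst prod.distrib) (simp add: mult_ac)
    qed (auto simp: lessThan_atLeast0)
    finally show ?thesis .
  qed
  have "det (X \<cdot>\<^sub>m 1\<^sub>m n + A) =
      (\<Sum>p | p permutes {0..<n}. signof p * (\<Prod>i = 0..<n. (X \<cdot>\<^sub>m 1\<^sub>m n + A) $$ (i, p i)))"
    using A by (intro det_def') simp
  also have "\<dots> = (\<Sum>p | p permutes {0..<n}. \<Sum>J\<in>Pow {..<n}. X ^ (n - card J) * (signof p *
      ((\<Prod>i\<in>J. A $$ (id i, p i)) * (\<Prod>i\<in>{0..<n} - J. if i = p i then 1 else 0))))"
    using expand by (intro sum.cong) (auto simp: sum_distrib_left mult.left_commute)
  also have "\<dots> = (\<Sum>J\<in>Pow {..<n}. X ^ (n - card J) * det (partial_rows n J id A))"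
    by (subst sum.swap) (auto simp: det_partial_rows sum_distrib_left intro!: sum.cong)
  finally show ?thesis .
qed

text \<open>Multilinearity: row \<open>f i\<close> of \<open>A * B\<close> is a combination of the
  rows \<open>q\<close> of \<open>B\<close>, and \<open>g i\<close> is the \<open>q\<close> chosen
  for \<open>i\<close>. It is the first half of the proof of Cauchy-Binet. The choice
  \<open>g\<close> takes the place of \<open>f\<close>, so the expansion can be iterated along a
  product; extensionality makes \<open>g\<close> depend on its values on \<open>J\<close>
  only.\<close>

lemma det_partial_rows_mult:
  fixes A B :: "'a::comm_ring_1 mat"
  assumes J: "J \<subseteq> {..<n}" and A: "A \<in> carrier_mat k l" and B: "B \<in> carrier_mat l n"
    and f: "f ` J \<subseteq> {..<k}"
  shows "det (partial_rows n J f (A * B)) =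
    (\<Sum>g\<in>J \<rightarrow>\<^sub>E {..<l}. (\<Prod>i\<in>J. A $$ (f i, g i)) * det (partial_rows n J g B))"
proof -
  have fin: "finite J" using J finite_subset by blast
  have expand: "(\<Prod>i\<in>J. (A * B) $$ (f i, p i)) =
      (\<Sum>g\<in>J \<rightarrow>\<^sub>E {..<l}. (\<Prod>i\<in>J. A $$ (f i, g i)) * (\<Prod>i\<in>J. B $$ (g i, p i)))"
    if p: "p permutes {0..<n}" for p
  proof -
    have pn: "p i < n" if "i < n" for i
      using permutes_in_image[OF p, of i] that by simp
    have "(\<Prod>i\<in>J. (A * B) $$ (f i, p i)) =
        (\<Prod>i\<in>J. \<Sum>q\<in>{..<l}. A $$ (f i, q) * B $$ (q, p i))"
    proof (intro prod.cong refl)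
      fix i assume "i \<in> J"
      then have "f i < k" "p i < n" using f J pn by auto
      then show "(A * B) $$ (f i, p i) = (\<Sum>q\<in>{..<l}. A $$ (f i, q) * B $$ (q, p i))"
        using A B by (auto simp: scalar_prod_def lessThan_atLeast0 intro!: sum.cong)
    qed
    also have "\<dots> = (\<Sum>g\<in>J \<rightarrow>\<^sub>E {..<l}. \<Prod>i\<in>J. A $$ (f i, g i) * B $$ (g i, p i))"
      using fin by (intro prod_sum_PiE) auto
    finally show ?thesis by (simp add: prod.distrib)
  qed
  have "det (partial_rows n J f (A * B)) =
      (\<Sum>p | p permutes {0..<n}. \<Sum>g\<in>J \<rightarrow>\<^sub>E {..<l}. (\<Prod>i\<in>J. A $$ (f i, g i)) *
        (signof p * ((\<Prod>i\<in>J. B $$ (g i, p i)) *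
          (\<Prod>i\<in>{0..<n} - J. if i = p i then 1 else 0))))"
    unfolding det_partial_rows[OF J]
  proof (intro sum.cong refl)
    fix p assume "p \<in> {p. p permutes {0..<n}}"
    then have p: "p permutes {0..<n}" by simp
    let ?u = "\<Prod>i\<in>{0..<n} - J. if i = p i then 1 else 0 :: 'a"
    show "signof p * ((\<Prod>i\<in>J. (A * B) $$ (f i, p i)) * ?u) =
        (\<Sum>g\<in>J \<rightarrow>\<^sub>E {..<l}. (\<Prod>i\<in>J. A $$ (f i, g i)) *
          (signof p * ((\<Prod>i\<in>J. B $$ (g i, p i)) * ?u)))"
      unfolding expand[OF p] sum_distrib_left sum_distrib_right
      by (intro sum.cong refl) (simp only: mult_ac)
  qed
  also have "\<dots> = (\<Sum>g\<in>J \<rightarrow>\<^sub>E {..<l}. (\<Prod>i\<in>J. A $$ (f i, g i)) * det (partial_rows n J g B))"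
    unfolding det_partial_rows[OF J] sum_distrib_left by (rule sum.swap)
  finally show ?thesis .
qed

lemma det_partial_rows_not_inj:
  fixes B :: "'a::comm_ring_1 mat"
  assumes J: "J \<subseteq> {..<n}" and g: "\<not> inj_on g J"
  shows "det (partial_rows n J g B) = 0"
proof -
  obtain i j where ij: "i \<in> J" "j \<in> J" "i \<noteq> j" "g i = g j"
    using g by (auto simp: inj_on_def)
  moreover have "i < n" "j < n" using ij J by auto
  ultimately have "row (partial_rows n J g B) i = row (partial_rows n J g B) j"
    by (intro eq_vecI) (auto simp: partial_rows_def)
  then show ?thesis
    using ij J by (intro det_identical_rows[OF partial_rows_carrier, of i j]) auto
qed

text \<open>Let all smaller points of \<open>J\<close> be fixed. Then \<open>i\<close> is not the
  image of a smaller point. If it were the image of a larger one, \<open>f i < i\<close> would be a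
  fixed point, whereas monotonicity gives \<open>f (f i) < f i\<close>.\<close>

lemma strict_mono_on_image_eq_imp_id:
  fixes f :: "'b::wellorder \<Rightarrow> 'b"
  assumes f: "strict_mono_on J f" and im: "f ` J = J" and "i \<in> J"
  shows "f i = i"
  using \<open>i \<in> J\<close>
proof (induction i rule: less_induct)
  case (less i)
  obtain i' where i': "i' \<in> J" "f i' = i" using less.prems im by (metis imageE)
  have "\<not> i' < i" using less.IH[of i'] i' by auto
  moreover have "\<not> i < i'"
  proof
    assume "i < i'"
    then have lt: "f i < i" using f i' less.prems by (auto simp: strict_mono_on_def)
    moreover have "f i \<in> J" using im less.prems by (metis imageI)
    ultimately have "f (f i) = f i" "f (f i) < f i"
      using less.IH[of "f i"] lt strict_mono_onD[OF f, of "f i" i] less.prems by auto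
    then show False by simp
  qed
  ultimately show ?case using i' by auto
qed

text \<open>The end of the path expansion: \<open>f\<close> holds the final positions of the paths.
  If they fill \<open>J\<close>, order preservation makes \<open>f\<close> the identity on
  \<open>J\<close>, so the matrix is the unit matrix and no sign appears.\<close>

lemma det_partial_rows_one:
  assumes J: "J \<subseteq> {..<n}" and f: "strict_mono_on J f" and fn: "f ` J \<subseteq> {..<n}"
  shows "det (partial_rows n J f (1\<^sub>m n)) = (if f ` J = J then 1 else (0::'a::comm_ring_1))"
proof (cases "f ` J = J")
  case True
  then have "partial_rows n J f (1\<^sub>m n :: 'a mat) = 1\<^sub>m n"
    using strict_mono_on_image_eq_imp_id[OF f True] J fn
    by (intro eq_matI) (auto simp: partial_rows_def)
  then show ?thesis using True by simp
next
  case False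
  have "finite J" using J finite_subset by blast
  moreover have "card (f ` J) = card J"
    using f by (simp add: card_image strict_mono_on_imp_inj_on)
  ultimately have "\<not> f ` J \<subseteq> J" using False card_subset_eq by blast
  then obtain i where i: "i \<in> J" "f i \<notin> J" by blast
  let ?P = "partial_rows n J f (1\<^sub>m n :: 'a mat)"
  have "i < n" "f i < n" using i J fn by auto
  \<comment> \<open>Both rows are the unit vector at \<open>f i\<close>: one because
    \<open>i\<close> lies in \<open>J\<close>, the other because \<open>f i\<close> does
    not.\<close>
  then have "row ?P i = row ?P (f i)"
    using i by (intro eq_vecI) (auto simp: partial_rows_def)
  then have "det ?P = 0"
    using i J fn by (intro det_identical_rows[OF partial_rows_carrier, of i "f i"]) auto
  then show ?thesis using False by simp
qed

section \<open>Matchings of strands and chains\<close>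

text \<open>Matchings need not be perfect: the vertices that they miss are left to the vertical
  edges.\<close>

definition strand_matchings :: "('a, 'b) strand_scheme \<Rightarrow> (nat \<times> nat) set set" where
  "strand_matchings S = {F. F \<subseteq> segs S \<and> inj_on fst F \<and> inj_on snd F}"

lemma finite_segs: "is_strand S \<Longrightarrow> finite (segs S)"
  unfolding is_strand_def by (meson finite_SigmaI finite_lessThan finite_subset)

lemma finite_strand_matchings: "is_strand S \<Longrightarrow> finite (strand_matchings S)"
  by (rule finite_subset[of _ "Pow (segs S)"]) (auto simp: strand_matchings_def finite_segs)

text \<open>Turns the planar drawing into a statement about order. If the order of the ends were
  reversed from bottom to top, the signed horizontal distance of the two segments would change its
  sign and vanish at a height in between, where they would cross. Equality \<open>q = q'\<close>
  remains possible, as two segments may share a top vertex.\<close>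

lemma segs_noncrossing:
  assumes S: "is_strand S" and e: "(p, q) \<in> segs S" "(p', q') \<in> segs S" and "p < p'"
  shows "q \<le> q'"
proof (rule ccontr)
  assume "\<not> q \<le> q'"
  then have "q' < q" by simp
  have nd: "noncrossing_drawable (bottoms S) (tops S) (segs S)"
    using S by (simp add: is_strand_def)
  have bd: "p < bottoms S" "p' < bottoms S" "q < tops S" "q' < tops S"
    using S e by (auto simp: is_strand_def)
  obtain a b :: "nat \<Rightarrow> real" and c d :: real where
    "strict_mono_on {..<bottoms S} a \<and> strict_mono_on {..<tops S} b \<and> c < d \<and>
     (\<forall>(p, q)\<in>segs S. \<forall>(p', q')\<in>segs S. (p, q) \<noteq> (p', q') \<longrightarrow>
       open_segment (a p, c) (b q, d) \<inter> open_segment (a p', c) (b q', d) = {})"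
    using nd[unfolded noncrossing_drawable_def] by (elim exE) (erule that)
  then have a: "strict_mono_on {..<bottoms S} a" and b: "strict_mono_on {..<tops S} b" and "c < d"
    and disj: "\<forall>(p, q)\<in>segs S. \<forall>(p', q')\<in>segs S. (p, q) \<noteq> (p', q') \<longrightarrow>
       open_segment (a p, c) (b q, d) \<inter> open_segment (a p', c) (b q', d) = {}"
    by - (elim conjE, assumption)+
  define u v where "u = a p' - a p" and "v = b q - b q'"
  have "u > 0" "v > 0"
    using strict_mono_onD[OF a, of p p'] strict_mono_onD[OF b, of q' q] bd \<open>p < p'\<close> \<open>q' < q\<close>
    by (auto simp: u_def v_def)
  \<comment> \<open>At relative height \<open>t\<close> the signed distance is
    \<open>(1 - t) * u - t * v\<close>; this \<open>t\<close> is its zero.\<close>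
  define t where "t = u / (u + v)"
  have t: "0 < t" "t < 1" using \<open>u > 0\<close> \<open>v > 0\<close> by (auto simp: t_def)
  have "(1 - t) * u = t * v"
    using \<open>u > 0\<close> \<open>v > 0\<close> by (simp add: t_def field_simps)
  then have eq: "(1 - t) *\<^sub>R (a p, c) + t *\<^sub>R (b q, d) = (1 - t) *\<^sub>R (a p', c) + t *\<^sub>R (b q', d)"
    by (simp add: u_def v_def algebra_simps)
  have "(1 - t) *\<^sub>R (a p, c) + t *\<^sub>R (b q, d) \<in> open_segment (a p, c) (b q, d)"
    using t \<open>c < d\<close> unfolding in_segment by auto
  moreover have "(1 - t) *\<^sub>R (a p, c) + t *\<^sub>R (b q, d) \<in> open_segment (a p', c) (b q', d)"
    unfolding eq using t \<open>c < d\<close> unfolding in_segment by auto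
  moreover have "open_segment (a p, c) (b q, d) \<inter> open_segment (a p', c) (b q', d) = {}"
    using bspec[OF bspec[OF disj e(1), unfolded prod.case] e(2), unfolded prod.case] \<open>p < p'\<close>
    by simp
  ultimately show False by blast
qed

text \<open>Noncrossing segments give weak monotonicity, and distinct top ends make it strict:
  vertex-disjoint paths keep their order when they traverse a strand.\<close>

lemma matching_step_strict_mono:
  fixes f g :: "nat \<Rightarrow> nat"
  assumes S: "is_strand S" and f: "strict_mono_on J f"
    and g: "inj_on g J" "\<And>i. i \<in> J \<Longrightarrow> (f i, g i) \<in> segs S"
  shows "strict_mono_on J g"
proof (rule strict_mono_onI)
  fix i j assume ij: "i \<in> J" "j \<in> J" "i < j"
  then have "f i < f j" using strict_mono_onD[OF f] by simp
  then have "g i \<le> g j" using segs_noncrossing[OF S g(2) g(2)] ij by blast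
  moreover have "g i \<noteq> g j" using inj_onD[OF g(1), of i j] ij by auto
  ultimately show "g i < g j" by simp
qed

lemma det_partial_rows_biadjacency_mult:
  fixes B :: "'a::comm_ring_1 mat" and S :: "'a strand"
  assumes S: "is_strand S" and J: "J \<subseteq> {..<n}" and B: "B \<in> carrier_mat (tops S) n"
    and f: "inj_on f J" and fk: "f ` J \<subseteq> {..<bottoms S}"
    and Z: "\<And>g. inj_on g J \<Longrightarrow> (\<And>i. i \<in> J \<Longrightarrow> (f i, g i) \<in> segs S) \<Longrightarrow>
      det (partial_rows n J g B) = Z (g ` J)"
  shows "det (partial_rows n J f (biadjacency S * B)) =
    (\<Sum>F | F \<in> strand_matchings S \<and> fst ` F = f ` J. (\<Prod>e\<in>F. seg_weight S e) * Z (snd ` F))"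
proof -
  define Gs where "Gs = {g \<in> J \<rightarrow>\<^sub>E {..<tops S}. inj_on g J \<and> (\<forall>i\<in>J. (f i, g i) \<in> segs S)}"
  define h where "h g = (\<lambda>i. (f i, g i)) ` J" for g :: "nat \<Rightarrow> nat"
  have fin: "finite J" using J finite_subset by blast
  have A: "biadjacency S \<in> carrier_mat (bottoms S) (tops S)" by (simp add: biadjacency_def)
  have "det (partial_rows n J f (biadjacency S * B)) =
      (\<Sum>g\<in>J \<rightarrow>\<^sub>E {..<tops S}.
        (\<Prod>i\<in>J. biadjacency S $$ (f i, g i)) * det (partial_rows n J g B))"
    by (rule det_partial_rows_mult[OF J A B fk])
  \<comment> \<open>A choice \<open>g\<close> outside \<open>Gs\<close> contributes 0: either it
    repeats a row of \<open>B\<close>, or it uses a pair that is not a segment and so meets a zero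
    entry.\<close>
  also have "\<dots> = (\<Sum>g\<in>Gs. (\<Prod>i\<in>J. biadjacency S $$ (f i, g i)) * det (partial_rows n J g B))"
  proof (rule sum.mono_neutral_right)
    show "finite (J \<rightarrow>\<^sub>E {..<tops S})" using fin by (intro finite_PiE) auto
    show "\<forall>g\<in>(J \<rightarrow>\<^sub>E {..<tops S}) - Gs.
        (\<Prod>i\<in>J. biadjacency S $$ (f i, g i)) * det (partial_rows n J g B) = 0"
    proof
      fix g assume g: "g \<in> (J \<rightarrow>\<^sub>E {..<tops S}) - Gs"
      show "(\<Prod>i\<in>J. biadjacency S $$ (f i, g i)) * det (partial_rows n J g B) = 0"
      proof (cases "inj_on g J")
        case True
        then obtain i where i: "i \<in> J" "(f i, g i) \<notin> segs S" using g by (auto simp: Gs_def)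
        then have "f i < bottoms S" "g i < tops S" using g fk by auto
        then have "biadjacency S $$ (f i, g i) = 0" using i by (simp add: biadjacency_def)
        then have "(\<Prod>i\<in>J. biadjacency S $$ (f i, g i)) = 0"
          using fin i by (intro prod_zero) auto
        then show ?thesis by simp
      qed (simp add: det_partial_rows_not_inj[OF J])
    qed
  qed (auto simp: Gs_def)
  also have "\<dots> = (\<Sum>g\<in>Gs. (\<Prod>e\<in>h g. seg_weight S e) * Z (snd ` h g))"
  proof (rule sum.cong[OF refl])
    fix g assume g: "g \<in> Gs"
    have "inj_on (\<lambda>i. (f i, g i)) J" using f by (auto simp: inj_on_def)
    then have "(\<Prod>e\<in>h g. seg_weight S e) = (\<Prod>i\<in>J. seg_weight S (f i, g i))"
      by (simp add: h_def prod.reindex)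
    also have "\<dots> = (\<Prod>i\<in>J. biadjacency S $$ (f i, g i))"
    proof (intro prod.cong refl)
      fix i assume "i \<in> J"
      then have "f i < bottoms S" "g i < tops S" "(f i, g i) \<in> segs S"
        using g fk by (auto simp: Gs_def)
      then show "seg_weight S (f i, g i) = biadjacency S $$ (f i, g i)"
        by (simp add: biadjacency_def)
    qed
    finally show "(\<Prod>i\<in>J. biadjacency S $$ (f i, g i)) * det (partial_rows n J g B) =
        (\<Prod>e\<in>h g. seg_weight S e) * Z (snd ` h g)"
      using g by (simp add: Z Gs_def h_def image_image)
  qed
  also have "\<dots> = (\<Sum>F\<in>h ` Gs. (\<Prod>e\<in>F. seg_weight S e) * Z (snd ` F))"
  proof (subst sum.reindex)
    show "inj_on h Gs"
    proof (rule inj_onI)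
      fix g g' assume g: "g \<in> Gs" "g' \<in> Gs" and eq: "h g = h g'"
      have "g i = g' i" if "i \<in> J" for i
      proof -
        have "(f i, g i) \<in> h g'" using that eq by (auto simp: h_def)
        then show ?thesis using f that by (auto simp: h_def dest: inj_onD)
      qed
      then show "g = g'" using g by (intro PiE_ext[of g J "\<lambda>_. {..<tops S}" g']) (auto simp: Gs_def)
    qed
  qed simp
  also have "h ` Gs = {F. F \<in> strand_matchings S \<and> fst ` F = f ` J}"
  proof (intro equalityI subsetI)
    fix F assume "F \<in> h ` Gs"
    then show "F \<in> {F. F \<in> strand_matchings S \<and> fst ` F = f ` J}"
      using f by (auto simp: h_def Gs_def strand_matchings_def image_image inj_on_def)
  next
    fix F assume "F \<in> {F. F \<in> strand_matchings S \<and> fst ` F = f ` J}"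
    then have F: "F \<subseteq> segs S" "inj_on fst F" "inj_on snd F" "fst ` F = f ` J"
      by (auto simp: strand_matchings_def)
    have "\<exists>q. (f i, q) \<in> F" if "i \<in> J" for i
    proof -
      have "f i \<in> fst ` F" using F(4) that by blast
      then show ?thesis by auto
    qed
    then obtain g0 where g0: "\<And>i. i \<in> J \<Longrightarrow> (f i, g0 i) \<in> F" by metis
    \<comment> \<open>The partner of \<open>f i\<close> in \<open>F\<close>, made undefined off
      \<open>J\<close> so that \<open>g\<close> lies in the extensional function space.\<close>
    define g where "g = restrict g0 J"
    have g: "(f i, g i) \<in> F" if "i \<in> J" for i using g0 that by (simp add: g_def)
    have "h g = F"
    proof (intro equalityI subsetI)
      fix e assume e: "e \<in> F"
      then have "fst e \<in> f ` J" using F(4) by blast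
      then obtain i where i: "i \<in> J" "fst e = f i" by blast
      then have "e = (f i, g i)" using inj_onD[OF F(2), of e "(f i, g i)"] e g by simp
      then show "e \<in> h g" using i by (simp add: h_def)
    qed (auto simp: h_def g)
    moreover have "g \<in> Gs"
    proof -
      have "inj_on g J"
      proof (rule inj_onI)
        fix i j assume "i \<in> J" "j \<in> J" "g i = g j"
        then have "(f i, g i) = (f j, g j)"
          using inj_onD[OF F(3), of "(f i, g i)" "(f j, g j)"] g[of i] g[of j] by simp
        then show "i = j" using f \<open>i \<in> J\<close> \<open>j \<in> J\<close> by (auto dest: inj_onD)
      qed
      moreover have "(f i, g i) \<in> segs S" "g i < tops S" if "i \<in> J" for i
        using g[OF that] F(1) S by (auto simp: is_strand_def)
      ultimately show ?thesis by (auto simp: Gs_def g_def)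
    qed
    ultimately show "F \<in> h ` Gs" by blast
  qed
  finally show ?thesis .
qed

text \<open>The set of positions entering level \<open>i\<close>; the value \<open>J\<close> at level \<open>m + 1\<close> prescribes the set that
  leaves the last strand.\<close>

definition chain_source :: "nat \<Rightarrow> nat set \<Rightarrow> (nat \<Rightarrow> (nat \<times> nat) set) \<Rightarrow> nat \<Rightarrow> nat set" where
  "chain_source m J F i = (if i \<le> m then fst ` F i else J)"

text \<open>The matchings of the strands from \<open>k\<close> to \<open>m\<close> fit together,
  with \<open>L\<close> entering at the bottom and \<open>J\<close> leaving at the top. For
  \<open>k = m + 1\<close> no strand is left and the condition on \<open>L\<close> reads
  \<open>J = L\<close>, which starts the recursion.\<close>

definition matching_chains ::
    "nat \<Rightarrow> (nat \<Rightarrow> 'a strand) \<Rightarrow> nat set \<Rightarrow> nat \<Rightarrow> nat set \<Rightarrow> (nat \<Rightarrow> (nat \<times> nat) set) set" where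
  "matching_chains m S J k L =
     {F \<in> (\<Pi>\<^sub>E i\<in>{k..m}. strand_matchings (S i)). chain_source m J F k = L \<and>
        (\<forall>i\<in>{k..m}. snd ` F i = chain_source m J F (Suc i))}"

definition chain_sum :: "nat \<Rightarrow> (nat \<Rightarrow> 'a::comm_ring_1 strand) \<Rightarrow> nat set \<Rightarrow> nat \<Rightarrow> nat set \<Rightarrow> 'a" where
  "chain_sum m S J k L =
     (\<Sum>F\<in>matching_chains m S J k L. \<Prod>i\<in>{k..m}. \<Prod>e\<in>F i. seg_weight (S i) e)"

section \<open>Recursion for sums over chains\<close>

lemma chain_sum_end: "chain_sum m S J (Suc m) L = (if L = J then 1 else 0)"
proof -
  have "matching_chains m S J (Suc m) L = (if L = J then {\<lambda>_. undefined} else {})"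
    by (auto simp: matching_chains_def chain_source_def)
  then show ?thesis by (simp add: chain_sum_def)
qed

text \<open>Together with \<open>matching_chain_restrict\<close> this splits a chain into its lowest
  matching and the rest. The index \<open>k\<close> lies outside the domain of \<open>G\<close>, so
  the update destroys nothing.\<close>

lemma matching_chain_upd:
  assumes "k \<le> m" and "F0 \<in> strand_matchings (S k)" and "G \<in> matching_chains m S J (Suc k) (snd ` F0)"
  shows "G(k := F0) \<in> matching_chains m S J k (fst ` F0)"
proof -
  have G: "G \<in> (\<Pi>\<^sub>E i\<in>{Suc k..m}. strand_matchings (S i))"
      "chain_source m J G (Suc k) = snd ` F0"
      "\<And>i. i \<in> {Suc k..m} \<Longrightarrow> snd ` G i = chain_source m J G (Suc i)"
    using assms(3) by (auto simp: matching_chains_def)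
  have src: "chain_source m J (G(k := F0)) i = chain_source m J G i" if "k < i" for i
    using that by (simp add: chain_source_def)
  have "G(k := F0) \<in> (\<Pi>\<^sub>E i\<in>{k..m}. strand_matchings (S i))"
    using G(1) assms(1,2) by (auto simp: PiE_def Pi_def extensional_def)
  moreover have "chain_source m J (G(k := F0)) k = fst ` F0"
    using assms(1) by (simp add: chain_source_def)
  moreover have "snd ` (G(k := F0)) i = chain_source m J (G(k := F0)) (Suc i)" if "i \<in> {k..m}" for i
    using that G(2,3) by (cases "i = k") (auto simp: src)
  ultimately show ?thesis by (auto simp: matching_chains_def)
qed

lemma matching_chain_restrict:
  assumes "k \<le> m" and "F \<in> matching_chains m S J k L"
  shows "F k \<in> strand_matchings (S k)" "fst ` F k = L"
    "restrict F {Suc k..m} \<in> matching_chains m S J (Suc k) (snd ` F k)"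
proof -
  have F: "F \<in> (\<Pi>\<^sub>E i\<in>{k..m}. strand_matchings (S i))" "chain_source m J F k = L"
      "\<And>i. i \<in> {k..m} \<Longrightarrow> snd ` F i = chain_source m J F (Suc i)"
    using assms(2) by (auto simp: matching_chains_def)
  have src: "chain_source m J (restrict F {Suc k..m}) i = chain_source m J F i" if "k < i" for i
    using that by (auto simp: chain_source_def)
  show "F k \<in> strand_matchings (S k)" using F(1) assms(1) by auto
  show "fst ` F k = L" using F(2) assms(1) by (simp add: chain_source_def)
  have "restrict F {Suc k..m} \<in> (\<Pi>\<^sub>E i\<in>{Suc k..m}. strand_matchings (S i))" using F(1) by auto
  moreover have "chain_source m J F (Suc k) = snd ` F k" using F(3)[of k] assms(1) by simp
  ultimately show "restrict F {Suc k..m} \<in> matching_chains m S J (Suc k) (snd ` F k)"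
    using F(3) by (auto simp: matching_chains_def src)
qed

lemma finite_matching_chains:
  assumes "\<And>i. i \<in> {k..m} \<Longrightarrow> is_strand (S i)"
  shows "finite (matching_chains m S J k L)"
proof (rule finite_subset)
  show "matching_chains m S J k L \<subseteq> (\<Pi>\<^sub>E i\<in>{k..m}. strand_matchings (S i))"
    by (auto simp: matching_chains_def)
qed (intro finite_PiE finite_strand_matchings assms; simp)

text \<open>A transfer recursion with the shape of \<open>det_partial_rows_biadjacency_mult\<close>,
  \<open>Z\<close> being the chain sum over the strands above. Hence determinants and chain sums can
  be compared by induction.\<close>

lemma chain_sum_step:
  fixes S :: "nat \<Rightarrow> 'a::comm_ring_1 strand"
  assumes S: "\<And>i. i \<in> {k..m} \<Longrightarrow> is_strand (S i)" and "k \<le> m"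
  shows "chain_sum m S J k L = (\<Sum>F | F \<in> strand_matchings (S k) \<and> fst ` F = L.
    (\<Prod>e\<in>F. seg_weight (S k) e) * chain_sum m S J (Suc k) (snd ` F))"
proof -
  let ?w = "\<lambda>l F. \<Prod>i\<in>{l..m}. \<Prod>e\<in>F i. seg_weight (S i) e"
  let ?M = "{F. F \<in> strand_matchings (S k) \<and> fst ` F = L}"
  have fin: "finite ?M"
    using finite_strand_matchings[OF S, of k] \<open>k \<le> m\<close> by simp
  have split: "{k..m} = insert k {Suc k..m}" using \<open>k \<le> m\<close> by auto
  have "(\<Sum>F\<in>?M. (\<Prod>e\<in>F. seg_weight (S k) e) * chain_sum m S J (Suc k) (snd ` F)) =
      (\<Sum>F\<in>?M. \<Sum>G\<in>matching_chains m S J (Suc k) (snd ` F).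
        (\<Prod>e\<in>F. seg_weight (S k) e) * ?w (Suc k) G)"
    by (simp add: chain_sum_def sum_distrib_left)
  also have "\<dots> = (\<Sum>(F, G)\<in>(SIGMA F:?M. matching_chains m S J (Suc k) (snd ` F)).
      (\<Prod>e\<in>F. seg_weight (S k) e) * ?w (Suc k) G)"
    by (rule sum.Sigma) (use fin S in \<open>auto intro!: finite_matching_chains\<close>)
  also have "\<dots> = (\<Sum>F\<in>matching_chains m S J k L. ?w k F)"
  proof (rule sum.reindex_bij_witness
      [where i = "\<lambda>F. (F k, restrict F {Suc k..m})" and j = "\<lambda>(F, G). G(k := F)"])
    fix FG assume FG: "FG \<in> (SIGMA F:?M. matching_chains m S J (Suc k) (snd ` F))"
    obtain F G where [simp]: "FG = (F, G)" by (cases FG)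
    have F: "F \<in> strand_matchings (S k)" "fst ` F = L"
      and G: "G \<in> matching_chains m S J (Suc k) (snd ` F)" using FG by auto
    have ext: "G \<in> extensional {Suc k..m}" using G by (auto simp: matching_chains_def PiE_def)
    then have "restrict (G(k := F)) {Suc k..m} = G"
      by (auto simp: fun_eq_iff extensional_def restrict_def)
    then show "((case FG of (F, G) \<Rightarrow> G(k := F)) k,
        restrict (case FG of (F, G) \<Rightarrow> G(k := F)) {Suc k..m}) = FG" by simp
    show "(case FG of (F, G) \<Rightarrow> G(k := F)) \<in> matching_chains m S J k L"
      using matching_chain_upd[OF \<open>k \<le> m\<close> F(1) G] F(2) by simp
    have "?w (Suc k) (G(k := F)) = ?w (Suc k) G" by (intro prod.cong) auto
    then show "?w k (case FG of (F, G) \<Rightarrow> G(k := F)) =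
        (case FG of (F, G) \<Rightarrow> (\<Prod>e\<in>F. seg_weight (S k) e) * ?w (Suc k) G)"
      by (simp add: split)
  next
    fix F assume F: "F \<in> matching_chains m S J k L"
    show "(F k, restrict F {Suc k..m}) \<in> (SIGMA F:?M. matching_chains m S J (Suc k) (snd ` F))"
      using matching_chain_restrict[OF \<open>k \<le> m\<close> F] by auto
    have "F \<in> extensional {k..m}" using F by (auto simp: matching_chains_def PiE_def)
    then show "(case (F k, restrict F {Suc k..m}) of (F, G) \<Rightarrow> G(k := F)) = F"
      using \<open>k \<le> m\<close> by (auto simp: fun_eq_iff extensional_def)
  qed
  finally show ?thesis by (simp add: chain_sum_def)
qed

section \<open>Minors of products of bi-adjacency matrices\<close>

text \<open>The induction removes factors from the left, so products have to start at any level; at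
  \<open>k = m + 1\<close> only the unit matrix is left.\<close>

definition tail_product :: "nat \<Rightarrow> (nat \<Rightarrow> 'a::semiring_1 strand) \<Rightarrow> nat \<Rightarrow> 'a mat" where
  "tail_product m S k =
     foldr (\<lambda>i B. biadjacency (S i) * B) [k..<Suc m] (1\<^sub>m (tops (S m)))"

lemma tail_product_step: "k \<le> m \<Longrightarrow> tail_product m S k = biadjacency (S k) * tail_product m S (Suc k)"
  unfolding tail_product_def by (subst upt_conv_Cons) simp_all

lemma tail_product_carrier:
  assumes "\<And>i. i \<in> {k..<m} \<Longrightarrow> tops (S i) = bottoms (S (Suc i))" and "k \<le> m"
  shows "tail_product m S k \<in> carrier_mat (bottoms (S k)) (tops (S m))"
  using assms(2,1)
proof (induction k rule: inc_induct)
  case base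
  then show ?case by (simp add: tail_product_step) (simp add: tail_product_def biadjacency_def)
next
  case (step k)
  then have "tail_product m S (Suc k) \<in> carrier_mat (tops (S k)) (tops (S m))" by simp
  then show ?case using step.hyps
    by (auto simp: tail_product_step[of k] biadjacency_def intro!: mult_carrier_mat[of _ _ "tops (S k)"])
qed

text \<open>Along a chain the positions of the paths keep their order, so paths leading from \<open>J\<close> back to
  \<open>J\<close> induce the identity permutation and no signs survive.\<close>

lemma det_partial_rows_tail_product:
  fixes S :: "nat \<Rightarrow> 'a::comm_ring_1 strand"
  assumes S: "\<And>i. i \<in> {k..m} \<Longrightarrow> is_strand (S i)"
    and tops: "\<And>i. i \<in> {k..<m} \<Longrightarrow> tops (S i) = bottoms (S (Suc i))"
    and J: "J \<subseteq> {..<tops (S m)}" and "k \<le> m"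
    and "strict_mono_on J f" and "f ` J \<subseteq> {..<bottoms (S k)}"
  shows "det (partial_rows (tops (S m)) J f (tail_product m S k)) = chain_sum m S J k (f ` J)"
  using \<open>k \<le> m\<close> S tops assms(5,6)
proof (induction k arbitrary: f rule: inc_induct)
  case base
  \<comment> \<open>The induction starts at the last strand, as \<open>bottoms (S (Suc m))\<close>
    would have no meaning. Above this strand only the unit matrix remains, whose determinant forces
    the paths to end in \<open>J\<close>.\<close>
  have tp: "tail_product m S (Suc m) = 1\<^sub>m (tops (S m))" by (simp add: tail_product_def)
  have "det (partial_rows (tops (S m)) J g (1\<^sub>m (tops (S m)) :: 'a mat)) =
      chain_sum m S J (Suc m) (g ` J)"
    if "inj_on g J" "\<And>i. i \<in> J \<Longrightarrow> (f i, g i) \<in> segs (S m)" for g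
  proof -
    have "strict_mono_on J g"
      using matching_step_strict_mono[of "S m" J f g] base that by auto
    moreover have "g ` J \<subseteq> {..<tops (S m)}"
      using that base.prems(1)[of m] by (auto simp: is_strand_def)
    ultimately show ?thesis by (simp add: det_partial_rows_one[OF J] chain_sum_end)
  qed
  then show ?case
    using det_partial_rows_biadjacency_mult[where Z = "chain_sum m S J (Suc m)" and S = "S m" and
        B = "1\<^sub>m (tops (S m))" and f = f, OF _ J] chain_sum_step[OF base.prems(1) order.refl, where J = J and L = "f ` J"]
      base.prems strict_mono_on_imp_inj_on[OF base.prems(3)]
    by (simp add: tail_product_step tp)
next
  case (step k)
  have kS: "is_strand (S k)" using step by simp
  have tk: "tops (S k) = bottoms (S (Suc k))" using step by simp
  have "tail_product m S (Suc k) \<in> carrier_mat (bottoms (S (Suc k))) (tops (S m))"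
    using step by (intro tail_product_carrier) auto
  then have carrier: "tail_product m S (Suc k) \<in> carrier_mat (tops (S k)) (tops (S m))"
    by (simp add: tk)
  \<comment> \<open>The new positions \<open>g\<close> are again in increasing order, so the
    induction hypothesis applies with \<open>g\<close> in place of \<open>f\<close>.\<close>
  have Z: "det (partial_rows (tops (S m)) J g (tail_product m S (Suc k))) =
      chain_sum m S J (Suc k) (g ` J)"
    if "inj_on g J" "\<And>i. i \<in> J \<Longrightarrow> (f i, g i) \<in> segs (S k)" for g
  proof (rule step.IH)
    show "strict_mono_on J g" using matching_step_strict_mono[OF kS] step.prems that by blast
    show "g ` J \<subseteq> {..<bottoms (S (Suc k))}"
      using that kS tk by (auto simp: is_strand_def)
  qed (use step in auto)
  show ?case
    using det_partial_rows_biadjacency_mult[where Z = "chain_sum m S J (Suc k)", OF kS J carrier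
        strict_mono_on_imp_inj_on[OF step.prems(3)] step.prems(4) Z]
      chain_sum_step[OF step.prems(1), where J = J and L = "f ` J"] step.hyps
    by (simp add: tail_product_step[of k])
qed

section \<open>Perfect matchings of fabric graphs\<close>

definition cyclic_chains :: "nat \<Rightarrow> (nat \<Rightarrow> 'a strand) \<Rightarrow> (nat \<Rightarrow> (nat \<times> nat) set) set" where
  "cyclic_chains m S = {F \<in> (\<Pi>\<^sub>E i\<in>{1..m}. strand_matchings (S i)).
     \<forall>i\<in>{1..m}. snd ` F i = fst ` F (cyclic_next m i)}"

text \<open>The vertical edges are forced: one stands above each top vertex that no segment reaches.
  In a cyclic chain the bottom vertex at its other end is then free as well.\<close>

definition chain_matching ::
    "nat \<Rightarrow> (nat \<Rightarrow> 'a strand) \<Rightarrow> (nat \<Rightarrow> (nat \<times> nat) set) \<Rightarrow> fabric_edge set" where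
  "chain_matching m S F =
     (\<lambda>(i, e). Segment i e) ` (SIGMA i:{1..m}. F i) \<union>
     (\<lambda>(i, j). Vertical i j) ` (SIGMA i:{1..m}. {..<tops (S i)} - snd ` F i)"

lemma Segment_in_chain_matching [simp]:
  "Segment i e \<in> chain_matching m S F \<longleftrightarrow> i \<in> {1..m} \<and> e \<in> F i"
  by (auto simp: chain_matching_def)

lemma Vertical_in_chain_matching [simp]:
  "Vertical i j \<in> chain_matching m S F \<longleftrightarrow> i \<in> {1..m} \<and> j < tops (S i) \<and> j \<notin> snd ` F i"
  by (auto simp: chain_matching_def)

section \<open>Perfect matchings of the cylinder as cyclic chains\<close>

lemma cyclic_next_in: "i \<in> {1..m} \<Longrightarrow> cyclic_next m i \<in> {1..m}"
  by (auto simp: cyclic_next_def)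

lemma cyclic_next_inj: "i \<in> {1..m} \<Longrightarrow> i' \<in> {1..m} \<Longrightarrow> cyclic_next m i = cyclic_next m i' \<longleftrightarrow> i = i'"
  by (auto simp: cyclic_next_def split: if_splits)

lemma cyclic_next_surj: "i \<in> {1..m} \<Longrightarrow> \<exists>i'\<in>{1..m}. cyclic_next m i' = i"
  by (rule bexI[of _ "if i = 1 then m else i - 1"]) (auto simp: cyclic_next_def)

text \<open>The edges at a vertex are some segments and one vertical edge. The map \<open>s\<close>
  inserts the fixed coordinate on either side, so that the lemma serves top and bottom vertices;
  \<open>i'\<close> differs from \<open>i\<close> at bottom vertices because a vertical edge carries
  the index of the strand from whose top it leaves.\<close>

lemma ex1_fabric_edge_iff:
  assumes "inj s"
  shows "(\<exists>!e. e \<in> M \<and> ((\<exists>p. e = Segment i (s p)) \<or> e = Vertical i' j)) \<longleftrightarrow>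
    (if Vertical i' j \<in> M then \<forall>p. Segment i (s p) \<notin> M else \<exists>!p. Segment i (s p) \<in> M)"
proof (cases "Vertical i' j \<in> M")
  case True
  then show ?thesis by auto
next
  case False
  have "(\<exists>!e. e \<in> M \<and> ((\<exists>p. e = Segment i (s p)) \<or> e = Vertical i' j)) \<longleftrightarrow>
      (\<exists>!p. Segment i (s p) \<in> M)"
  proof
    assume "\<exists>!e. e \<in> M \<and> ((\<exists>p. e = Segment i (s p)) \<or> e = Vertical i' j)"
    then obtain p where p: "Segment i (s p) \<in> M"
      and un: "\<And>e. e \<in> M \<Longrightarrow> (\<exists>p. e = Segment i (s p)) \<Longrightarrow> e = Segment i (s p)"
      using False by (elim ex1E) metis
    show "\<exists>!p. Segment i (s p) \<in> M"
      using p un assms by (metis fabric_edge.inject(1) injD)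
  next
    assume "\<exists>!p. Segment i (s p) \<in> M"
    then show "\<exists>!e. e \<in> M \<and> ((\<exists>p. e = Segment i (s p)) \<or> e = Vertical i' j)"
      using False by metis
  qed
  then show ?thesis using False by simp
qed

text \<open>The vertices are grouped by vertical edges: as \<open>cyclic_next m\<close> permutes
  \<open>{1..m}\<close>, every bottom vertex is the second end of exactly one of them. Both
  conditions at \<open>(i, j)\<close> then speak of the same edge
  \<open>Vertical i j\<close>.\<close>

lemma perfect_matchings_cylindrical_iff:
  assumes "cylindrical_strands m S"
  shows "M \<in> perfect_matchings (cylindrical_fabric m S x) \<longleftrightarrow>
    M \<subseteq> arcs (cylindrical_fabric m S x) \<and>
    (\<forall>i\<in>{1..m}. \<forall>j<tops (S i).
       (if Vertical i j \<in> M then \<forall>p. Segment i (p, j) \<notin> M else \<exists>!p. Segment i (p, j) \<in> M) \<and>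
       (if Vertical i j \<in> M then \<forall>q. Segment (cyclic_next m i) (j, q) \<notin> M
        else \<exists>!q. Segment (cyclic_next m i) (j, q) \<in> M))"
proof (cases "M \<subseteq> arcs (cylindrical_fabric m S x)")
  case False
  then show ?thesis by (simp add: perfect_matchings_def)
next
  case True
  let ?n = "cyclic_next m"
  let ?c = "\<lambda>v. \<exists>!e. e \<in> M \<and> v \<in> fabric_ends ?n e"
  have top: "?c (i, Top j) \<longleftrightarrow>
      (if Vertical i j \<in> M then \<forall>p. Segment i (p, j) \<notin> M else \<exists>!p. Segment i (p, j) \<in> M)" for i j
  proof -
    have "(i, Top j) \<in> fabric_ends ?n e \<longleftrightarrow> (\<exists>p. e = Segment i (p, j)) \<or> e = Vertical i j" for e
      by (cases e) auto
    then show ?thesis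
      using ex1_fabric_edge_iff[of "\<lambda>p. (p, j)" M i i j] by (simp add: inj_def)
  qed
  have bottom: "?c (?n i, Bottom j) \<longleftrightarrow>
      (if Vertical i j \<in> M then \<forall>q. Segment (?n i) (j, q) \<notin> M
       else \<exists>!q. Segment (?n i) (j, q) \<in> M)" if i: "i \<in> {1..m}" for i j
  proof -
    \<comment> \<open>Among vertical edges only the one from strand \<open>i\<close> ends here. The
      successor map is injective on \<open>{1..m}\<close>, and membership in \<open>M\<close>
      confines the index to this range.\<close>
    have "e \<in> M \<and> (?n i, Bottom j) \<in> fabric_ends ?n e \<longleftrightarrow>
        e \<in> M \<and> ((\<exists>q. e = Segment (?n i) (j, q)) \<or> e = Vertical i j)" for e
    proof (cases e)
      case (Vertical i' j')
      then have "i' \<in> {1..m}" if "e \<in> M" using that True by (auto simp: cylindrical_fabric_def)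
      then show ?thesis using cyclic_next_inj[OF i, of i'] Vertical by auto
    qed auto
    then show ?thesis
      using ex1_fabric_edge_iff[of "\<lambda>q. (j, q)" M "?n i" i j] by (simp add: inj_def)
  qed
  have tops: "tops (S i) = bottoms (S (?n i))" if "i \<in> {1..m}" for i
    using assms that by (auto simp: cylindrical_strands_def)
  have reindex: "(\<forall>i\<in>{1..m}. Q i) \<longleftrightarrow> (\<forall>i\<in>{1..m}. Q (?n i))" for Q
    using cyclic_next_in cyclic_next_surj by (metis (no_types))
  have verts: "(\<forall>v\<in>(SIGMA i:{1..m}. strand_verts (S i)). P v) \<longleftrightarrow>
      (\<forall>i\<in>{1..m}. (\<forall>j<tops (S i). P (i, Top j)) \<and> (\<forall>j<bottoms (S i). P (i, Bottom j)))" for P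
    by (auto simp: strand_verts_def)
  have "M \<in> perfect_matchings (cylindrical_fabric m S x) \<longleftrightarrow>
      (\<forall>v\<in>(SIGMA i:{1..m}. strand_verts (S i)). ?c v)"
    using True by (simp add: perfect_matchings_def cylindrical_fabric_def)
  also have "\<dots> \<longleftrightarrow> (\<forall>i\<in>{1..m}. (\<forall>j<tops (S i). ?c (i, Top j)) \<and> (\<forall>j<bottoms (S i). ?c (i, Bottom j)))"
    by (rule verts)
  also have "\<dots> \<longleftrightarrow> (\<forall>i\<in>{1..m}. \<forall>j<tops (S i). ?c (i, Top j)) \<and>
      (\<forall>i\<in>{1..m}. \<forall>j<bottoms (S i). ?c (i, Bottom j))" by blast
  also have "(\<forall>i\<in>{1..m}. \<forall>j<bottoms (S i). ?c (i, Bottom j)) \<longleftrightarrow>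
      (\<forall>i\<in>{1..m}. \<forall>j<tops (S i). ?c (?n i, Bottom j))"
    by (subst reindex) (simp add: tops)
  also have "(\<forall>i\<in>{1..m}. \<forall>j<tops (S i). ?c (i, Top j)) \<and>
      (\<forall>i\<in>{1..m}. \<forall>j<tops (S i). ?c (?n i, Bottom j)) \<longleftrightarrow>
      (\<forall>i\<in>{1..m}. \<forall>j<tops (S i). ?c (i, Top j) \<and> ?c (?n i, Bottom j))" by blast
  also have "\<dots> \<longleftrightarrow> (\<forall>i\<in>{1..m}. \<forall>j<tops (S i).
       (if Vertical i j \<in> M then \<forall>p. Segment i (p, j) \<notin> M else \<exists>!p. Segment i (p, j) \<in> M) \<and>
       (if Vertical i j \<in> M then \<forall>q. Segment (?n i) (j, q) \<notin> M
        else \<exists>!q. Segment (?n i) (j, q) \<in> M))"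
    by (intro ball_cong refl all_cong) (simp only: top bottom)
  finally show ?thesis using True by blast
qed

lemma strand_matching_bounds:
  assumes "is_strand S" and "F \<in> strand_matchings S"
  shows "fst ` F \<subseteq> {..<bottoms S}" "snd ` F \<subseteq> {..<tops S}"
  using assms by (auto simp: strand_matchings_def is_strand_def)

lemma strand_matching_ex1:
  assumes "F \<in> strand_matchings S"
  shows "j \<in> fst ` F \<Longrightarrow> \<exists>!q. (j, q) \<in> F" "j \<in> snd ` F \<Longrightarrow> \<exists>!p. (p, j) \<in> F"
  using assms by (force simp: strand_matchings_def inj_on_def)+

text \<open>A chain is recovered from the segments of its matching. Conversely, a missing
  \<open>Vertical i j\<close> means exactly that a segment ends at its lower end, and also exactly
  that a segment starts at its upper end; comparing the two yields the linking condition.\<close>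

lemma bij_betw_chain_matching:
  assumes cyl: "cylindrical_strands m S"
  shows "bij_betw (chain_matching m S) (cyclic_chains m S)
    (perfect_matchings (cylindrical_fabric m S x))"
proof (rule bij_betw_imageI)
  let ?n = "cyclic_next m"
  have S: "is_strand (S i)" if "i \<in> {1..m}" for i
    using cyl that by (simp add: cylindrical_strands_def)
  have tops: "tops (S i) = bottoms (S (?n i))" if "i \<in> {1..m}" for i
    using cyl that by (auto simp: cylindrical_strands_def)
  show "inj_on (chain_matching m S) (cyclic_chains m S)"
  proof (rule inj_onI)
    fix F G assume F: "F \<in> cyclic_chains m S" and G: "G \<in> cyclic_chains m S"
      and eq: "chain_matching m S F = chain_matching m S G"
    have "F i = G i" if "i \<in> {1..m}" for i
    proof (rule Set.set_eqI)
      fix e show "e \<in> F i \<longleftrightarrow> e \<in> G i"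
        using that Segment_in_chain_matching[of i e m S F] Segment_in_chain_matching[of i e m S G]
        by (simp add: eq)
    qed
    moreover have "F \<in> (\<Pi>\<^sub>E i\<in>{1..m}. strand_matchings (S i))"
      "G \<in> (\<Pi>\<^sub>E i\<in>{1..m}. strand_matchings (S i))"
      using F G unfolding cyclic_chains_def by blast+
    ultimately show "F = G" by (intro PiE_ext[of F "{1..m}" _ G])
  qed
  show "chain_matching m S ` cyclic_chains m S = perfect_matchings (cylindrical_fabric m S x)"
  proof (intro equalityI subsetI)
    fix M assume "M \<in> chain_matching m S ` cyclic_chains m S"
    then obtain F where F: "F \<in> cyclic_chains m S" and M: "M = chain_matching m S F" by blast
    have Fi: "F i \<in> strand_matchings (S i)" if "i \<in> {1..m}" for i
      using F that by (auto simp: cyclic_chains_def)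
    have link: "snd ` F i = fst ` F (?n i)" if "i \<in> {1..m}" for i
      using F that by (auto simp: cyclic_chains_def)
    have "M \<subseteq> arcs (cylindrical_fabric m S x)"
    proof
      fix e assume "e \<in> M"
      moreover have "F i \<subseteq> segs (S i)" if "i \<in> {1..m}" for i
        using Fi[OF that] by (simp add: strand_matchings_def)
      ultimately show "e \<in> arcs (cylindrical_fabric m S x)"
        by (cases e) (auto simp: M cylindrical_fabric_def)
    qed
    moreover have "(if Vertical i j \<in> M then \<forall>p. Segment i (p, j) \<notin> M else \<exists>!p. Segment i (p, j) \<in> M)"
      if "i \<in> {1..m}" "j < tops (S i)" for i j
      using that strand_matching_ex1(2)[OF Fi[of i], of j] by (force simp: M)
    moreover have "(if Vertical i j \<in> M then \<forall>q. Segment (?n i) (j, q) \<notin> M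
        else \<exists>!q. Segment (?n i) (j, q) \<in> M)"
      if i: "i \<in> {1..m}" "j < tops (S i)" for i j
      using i cyclic_next_in[OF i(1)] strand_matching_ex1(1)[OF Fi[OF cyclic_next_in[OF i(1)]], of j]
        link[OF i(1)]
      by (force simp: M)
    ultimately show "M \<in> perfect_matchings (cylindrical_fabric m S x)"
      unfolding perfect_matchings_cylindrical_iff[OF cyl] by blast
  next
    fix M assume "M \<in> perfect_matchings (cylindrical_fabric m S x)"
    then have sub: "M \<subseteq> arcs (cylindrical_fabric m S x)"
      and top: "\<And>i j. i \<in> {1..m} \<Longrightarrow> j < tops (S i) \<Longrightarrow>
        if Vertical i j \<in> M then \<forall>p. Segment i (p, j) \<notin> M else \<exists>!p. Segment i (p, j) \<in> M"
      and bottom: "\<And>i j. i \<in> {1..m} \<Longrightarrow> j < tops (S i) \<Longrightarrow>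
        if Vertical i j \<in> M then \<forall>q. Segment (?n i) (j, q) \<notin> M
        else \<exists>!q. Segment (?n i) (j, q) \<in> M"
      unfolding perfect_matchings_cylindrical_iff[OF cyl] by blast+
    define F where "F = (\<lambda>i\<in>{1..m}. {e. Segment i e \<in> M})"
    have Fi [simp]: "e \<in> F i \<longleftrightarrow> Segment i e \<in> M" if "i \<in> {1..m}" for i e
      using that by (simp add: F_def)
    have segs: "i \<in> {1..m}" "e \<in> segs (S i)" if "Segment i e \<in> M" for i e
      using that sub by (auto simp: cylindrical_fabric_def)
    have verts: "i \<in> {1..m}" "j < tops (S i)" if "Vertical i j \<in> M" for i j
      using that sub by (auto simp: cylindrical_fabric_def)
    have seg_lt: "p < bottoms (S i)" "q < tops (S i)" if "Segment i (p, q) \<in> M" for i p q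
      using segs[OF that] S by (auto simp: is_strand_def)
    have snd_iff: "j \<in> snd ` F i \<longleftrightarrow> j < tops (S i) \<and> Vertical i j \<notin> M" if "i \<in> {1..m}" for i j
    proof -
      have "j \<in> snd ` F i \<longleftrightarrow> (\<exists>p. Segment i (p, j) \<in> M)"
        using that by (force simp: image_iff)
      also have "\<dots> \<longleftrightarrow> j < tops (S i) \<and> Vertical i j \<notin> M"
        using top[OF that, of j] seg_lt(2)[of i _ j] by (auto split: if_splits)
      finally show ?thesis .
    qed
    have fst_iff: "j \<in> fst ` F (?n i) \<longleftrightarrow> j < tops (S i) \<and> Vertical i j \<notin> M"
      if "i \<in> {1..m}" for i j
    proof -
      have "j \<in> fst ` F (?n i) \<longleftrightarrow> (\<exists>q. Segment (?n i) (j, q) \<in> M)"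
        using cyclic_next_in[OF that] by (force simp: image_iff)
      also have "\<dots> \<longleftrightarrow> j < tops (S i) \<and> Vertical i j \<notin> M"
        using bottom[OF that, of j] seg_lt(1)[of "?n i" j] tops[OF that] by (auto split: if_splits)
      finally show ?thesis .
    qed
    have "F i \<in> strand_matchings (S i)" if i: "i \<in> {1..m}" for i
    proof -
      \<comment> \<open>The covering conditions at the bottom of strand \<open>i\<close> are indexed
        by its predecessor \<open>i'\<close>.\<close>
      obtain i' where i': "i' \<in> {1..m}" "?n i' = i" using cyclic_next_surj[OF i] by blast
      have "inj_on fst (F i)"
      proof (rule inj_onI)
        fix e e' assume "e \<in> F i" "e' \<in> F i" "fst e = fst e'"
        then obtain j q q' where e: "e = (j, q)" "e' = (j, q')"
          and M: "Segment i (j, q) \<in> M" "Segment i (j, q') \<in> M"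
          using i by (cases e; cases e') auto
        then show "e = e'"
          using bottom[OF i'(1), of j] seg_lt(1)[OF M(1)] tops[OF i'(1)] i'(2)
          by (auto split: if_splits)
      qed
      moreover have "inj_on snd (F i)"
      proof (rule inj_onI)
        fix e e' assume "e \<in> F i" "e' \<in> F i" "snd e = snd e'"
        then obtain j p p' where e: "e = (p, j)" "e' = (p', j)"
          and M: "Segment i (p, j) \<in> M" "Segment i (p', j) \<in> M"
          using i by (cases e; cases e') auto
        then show "e = e'"
          using top[OF i, of j] seg_lt(2)[OF M(1)] by (auto split: if_splits)
      qed
      ultimately show ?thesis using i segs by (auto simp: strand_matchings_def)
    qed
    moreover have "snd ` F i = fst ` F (?n i)" if "i \<in> {1..m}" for i
      using snd_iff[OF that] fst_iff[OF that] by blast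
    ultimately have "F \<in> cyclic_chains m S"
      by (auto simp: cyclic_chains_def F_def)
    moreover have "chain_matching m S F = M"
    proof (rule Set.set_eqI)
      fix e show "e \<in> chain_matching m S F \<longleftrightarrow> e \<in> M"
      proof (cases e)
        case (Segment i f)
        then show ?thesis using segs[of i f] by auto
      next
        case (Vertical i j)
        then show ?thesis
          using verts[of i j] snd_iff[of i j]
          unfolding Vertical Vertical_in_chain_matching by blast
      qed
    qed
    ultimately show "M \<in> chain_matching m S ` cyclic_chains m S" by blast
  qed
qed

section \<open>Weights and sizes of cyclic chains\<close>

lemma chain_matching_weight:
  fixes S :: "nat \<Rightarrow> 'a::comm_semiring_1 strand"
  assumes cyl: "cylindrical_strands m S" and F: "F \<in> cyclic_chains m S"
  shows "(\<Prod>e\<in>chain_matching m S F. fabric_weight S x e) =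
    (\<Prod>i\<in>{1..m}. \<Prod>e\<in>F i. seg_weight (S i) e) *
    (\<Prod>i\<in>{1..m}. x i ^ (tops (S i) - card (F i)))"
proof -
  have S: "is_strand (S i)" and Fi: "F i \<in> strand_matchings (S i)" if "i \<in> {1..m}" for i
    using cyl F that by (auto simp: cylindrical_strands_def cyclic_chains_def)
  have fin: "finite (F i)" if "i \<in> {1..m}" for i
    using Fi[OF that] finite_segs[OF S[OF that]]
    by (auto simp: strand_matchings_def intro: finite_subset)
  let ?A = "SIGMA i:{1..m}. F i" and ?B = "SIGMA i:{1..m}. {..<tops (S i)} - snd ` F i"
  have "(\<Prod>e\<in>chain_matching m S F. fabric_weight S x e) =
      (\<Prod>e\<in>(\<lambda>(i, e). Segment i e) ` ?A. fabric_weight S x e) *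
      (\<Prod>e\<in>(\<lambda>(i, j). Vertical i j) ` ?B. fabric_weight S x e)"
    unfolding chain_matching_def using finite_SigmaI[OF _ fin, of "{1..m}"]
    by (intro prod.union_disjoint) (auto simp del: finite_SigmaI)
  also have "(\<Prod>e\<in>(\<lambda>(i, e). Segment i e) ` ?A. fabric_weight S x e) =
      (\<Prod>(i, e)\<in>?A. seg_weight (S i) e)"
    by (subst prod.reindex) (auto simp: inj_on_def intro!: prod.cong)
  also have "\<dots> = (\<Prod>i\<in>{1..m}. \<Prod>e\<in>F i. seg_weight (S i) e)"
    using fin by (intro prod.Sigma[symmetric]) auto
  also have "(\<Prod>e\<in>(\<lambda>(i, j). Vertical i j) ` ?B. fabric_weight S x e) = (\<Prod>(i, j)\<in>?B. x i)"
    by (subst prod.reindex) (auto simp: inj_on_def intro!: prod.cong)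
  also have "\<dots> = (\<Prod>i\<in>{1..m}. \<Prod>j\<in>{..<tops (S i)} - snd ` F i. x i)"
    by (intro prod.Sigma[symmetric]) auto
  also have "\<dots> = (\<Prod>i\<in>{1..m}. x i ^ (tops (S i) - card (F i)))"
  proof (intro prod.cong refl)
    fix i assume i: "i \<in> {1..m}"
    have "card (snd ` F i) = card (F i)"
      using Fi[OF i] by (intro card_image) (simp add: strand_matchings_def)
    then have "card ({..<tops (S i)} - snd ` F i) = tops (S i) - card (F i)"
      using strand_matching_bounds(2)[OF S[OF i] Fi[OF i]] fin[OF i]
      by (simp add: card_Diff_subset)
    then show "(\<Prod>j\<in>{..<tops (S i)} - snd ` F i. x i) = x i ^ (tops (S i) - card (F i))" by simp
  qed
  finally show ?thesis .
qed

lemma cyclic_chain_card: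
  assumes F: "F \<in> cyclic_chains m S" and "i \<in> {1..m}"
  shows "card (F i) = card (fst ` F 1)"
proof -
  have Fi: "inj_on fst (F i)" "inj_on snd (F i)" if "i \<in> {1..m}" for i
    using F that by (auto simp: cyclic_chains_def strand_matchings_def)
  have "1 \<le> i" "i \<le> m" using assms(2) by auto
  then show ?thesis
  proof (induction i rule: nat_induct_at_least)
    case base
    then show ?case using Fi(1)[of 1] by (simp add: card_image)
  next
    case (Suc i)
    then have i: "i \<in> {1..m}" "cyclic_next m i = Suc i" by (auto simp: cyclic_next_def)
    have "card (F (Suc i)) = card (fst ` F (Suc i))"
      using Fi(1)[of "Suc i"] Suc.prems by (simp add: card_image)
    also have "fst ` F (Suc i) = snd ` F i" using F i by (auto simp: cyclic_chains_def)
    also have "card \<dots> = card (F i)" using Fi(2)[OF i(1)] by (simp add: card_image)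
    finally show ?case using Suc by simp
  qed
qed

text \<open>The cylinder is cut between strand \<open>m\<close> and strand \<open>1\<close>: the
  linking condition at \<open>m\<close> turns into the prescribed end \<open>J\<close>.\<close>

lemma matching_chains_closed:
  assumes "1 \<le> m"
  shows "{F \<in> cyclic_chains m S. fst ` F 1 = J} = matching_chains m S J 1 J"
proof -
  have "fst ` F (cyclic_next m i) = chain_source m J F (Suc i)"
    if "fst ` F 1 = J" "i \<in> {1..m}" for F i
    using that by (auto simp: cyclic_next_def chain_source_def)
  then have link: "(\<forall>i\<in>{1..m}. snd ` F i = fst ` F (cyclic_next m i)) \<longleftrightarrow>
      (\<forall>i\<in>{1..m}. snd ` F i = chain_source m J F (Suc i))" if "fst ` F 1 = J" for F
    using that by simp
  have src: "chain_source m J F 1 = fst ` F 1" for F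
    using assms by (simp add: chain_source_def)
  show ?thesis
  proof (rule Set.set_eqI)
    fix F
    show "F \<in> {F \<in> cyclic_chains m S. fst ` F 1 = J} \<longleftrightarrow> F \<in> matching_chains m S J 1 J"
      unfolding cyclic_chains_def matching_chains_def mem_Collect_eq src
      by (cases "fst ` F 1 = J") (simp_all only: link simp_thms)
  qed
qed

lemma matching_sum_cylindrical:
  fixes S :: "nat \<Rightarrow> 'a::field strand" and x :: "nat \<Rightarrow> 'a"
  assumes cyl: "cylindrical_strands m S"
    and nz: "\<forall>i\<in>{1..<m}. tops (S i) < tops (S m) \<longrightarrow> x i \<noteq> 0"
  shows "matching_sum (cylindrical_fabric m S x) =
    (\<Prod>i\<in>{1..<m}. x i powi (int (tops (S i)) - int (tops (S m)))) *
    det ((\<Prod>i\<in>{1..m}. x i) \<cdot>\<^sub>m 1\<^sub>m (tops (S m)) + biadjacency_product m S)"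
proof -
  define n where "n = tops (S m)"
  define P where "P = (\<Prod>i\<in>{1..<m}. x i powi (int (tops (S i)) - int n))"
  define X where "X = (\<Prod>i\<in>{1..m}. x i)"
  let ?w = "\<lambda>F. \<Prod>i\<in>{1..m}. \<Prod>e\<in>F i. seg_weight (S i) e"
  have m: "1 \<le> m" and S: "\<And>i. i \<in> {1..m} \<Longrightarrow> is_strand (S i)"
    and tops: "\<And>i. i \<in> {1..<m} \<Longrightarrow> tops (S i) = bottoms (S (Suc i))"
    using cyl by (auto simp: cylindrical_strands_def cyclic_next_def)
  have closed: "bottoms (S 1) = n"
    using cyl m by (auto simp: cylindrical_strands_def cyclic_next_def n_def)
  \<comment> \<open>Here \<open>c\<close> is the number of paths, and the exponent
    \<open>tops (S i) - c\<close> is split as \<open>(tops (S i) - n) + (n - c)\<close>. If the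
    first summand is negative, \<open>x i\<close> has to be invertible, which \<open>nz\<close>
    provides; otherwise all powers are natural and \<open>x i\<close> may be 0.\<close>
  have power: "(\<Prod>i\<in>{1..m}. x i ^ (tops (S i) - c)) = P * X ^ (n - c)"
    if c: "\<And>i. i \<in> {1..m} \<Longrightarrow> c \<le> tops (S i)" for c
  proof -
    have "x i ^ (tops (S i) - c) = x i powi (int (tops (S i)) - int n) * x i ^ (n - c)"
      if i: "i \<in> {1..<m}" for i
    proof -
      have le: "c \<le> tops (S i)" "c \<le> n" using c[of i] c[of m] i by (auto simp: n_def)
      show ?thesis
      proof (cases "n \<le> tops (S i)")
        case True
        then have "x i powi (int (tops (S i)) - int n) = x i ^ (tops (S i) - n)"
          by (metis of_nat_diff power_int_of_nat)
        then show ?thesis using True le by (simp flip: power_add)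
      next
        case False
        then have "x i \<noteq> 0" using nz i by (auto simp: n_def)
        have "x i powi (int (tops (S i)) - int n) * x i ^ (n - c) =
            x i powi ((int (tops (S i)) - int n) + int (n - c))"
          using \<open>x i \<noteq> 0\<close> by (subst power_int_add) auto
        also have "(int (tops (S i)) - int n) + int (n - c) = int (tops (S i) - c)"
          using le by simp
        finally show ?thesis by simp
      qed
    qed
    then have "(\<Prod>i\<in>{1..<m}. x i ^ (tops (S i) - c)) = P * (\<Prod>i\<in>{1..<m}. x i ^ (n - c))"
      unfolding P_def prod.distrib[symmetric] by (intro prod.cong) auto
    \<comment> \<open>The last strand needs no correction, since \<open>tops (S m) = n\<close>; so
      \<open>P\<close> stops at \<open>m - 1\<close> while \<open>X\<close> runs up to
      \<open>m\<close>.\<close>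
    moreover have "{1..m} = insert m {1..<m}" using m by auto
    ultimately show ?thesis by (simp add: X_def prod_power_distrib power_mult_distrib n_def)
  qed
  have bounds: "c \<le> tops (S i)" if "F \<in> cyclic_chains m S" "i \<in> {1..m}" "c = card (fst ` F 1)" for F c i
  proof -
    have Fi: "F i \<in> strand_matchings (S i)" using that by (auto simp: cyclic_chains_def)
    then have "card (F i) = card (snd ` F i)"
      by (simp add: card_image strand_matchings_def)
    also have "\<dots> \<le> tops (S i)"
      using card_mono[OF _ strand_matching_bounds(2)[OF S[OF that(2)] Fi]] by simp
    finally show ?thesis using cyclic_chain_card[OF that(1,2)] that(3) by simp
  qed
  have fin: "finite (cyclic_chains m S)"
  proof (rule finite_subset)
    show "cyclic_chains m S \<subseteq> (\<Pi>\<^sub>E i\<in>{1..m}. strand_matchings (S i))"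
      by (auto simp: cyclic_chains_def)
  qed (intro finite_PiE finite_strand_matchings S; simp)
  have "matching_sum (cylindrical_fabric m S x) =
      (\<Sum>M\<in>perfect_matchings (cylindrical_fabric m S x). \<Prod>e\<in>M. fabric_weight S x e)"
    by (simp add: matching_sum_def cylindrical_fabric_def)
  also have "\<dots> = (\<Sum>F\<in>cyclic_chains m S. \<Prod>e\<in>chain_matching m S F. fabric_weight S x e)"
    by (rule sum.reindex_bij_betw[OF bij_betw_chain_matching[OF cyl], symmetric])
  also have "\<dots> = (\<Sum>F\<in>cyclic_chains m S. P * (X ^ (n - card (fst ` F 1)) * ?w F))"
  proof (rule sum.cong[OF refl])
    fix F assume F: "F \<in> cyclic_chains m S"
    have "(\<Prod>i\<in>{1..m}. x i ^ (tops (S i) - card (F i))) =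
        (\<Prod>i\<in>{1..m}. x i ^ (tops (S i) - card (fst ` F 1)))"
      using cyclic_chain_card[OF F] by (intro prod.cong) auto
    also have "\<dots> = P * X ^ (n - card (fst ` F 1))"
      by (rule power) (use bounds[OF F] in blast)
    finally show "(\<Prod>e\<in>chain_matching m S F. fabric_weight S x e) =
        P * (X ^ (n - card (fst ` F 1)) * ?w F)"
      by (simp only: chain_matching_weight[OF cyl F] mult_ac)
  qed
  also have "\<dots> = P * (\<Sum>F\<in>cyclic_chains m S. X ^ (n - card (fst ` F 1)) * ?w F)"
    by (simp only: sum_distrib_left)
  also have "(\<Sum>F\<in>cyclic_chains m S. X ^ (n - card (fst ` F 1)) * ?w F) =
      (\<Sum>J\<in>Pow {..<n}. \<Sum>F\<in>{F \<in> cyclic_chains m S. fst ` F 1 = J}.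
        X ^ (n - card (fst ` F 1)) * ?w F)"
  \<comment> \<open>The chains are grouped by the set \<open>J\<close> of bottom vertices of the
    first strand that they use.\<close>
  proof (rule sum.group[symmetric, OF fin])
    show "(\<lambda>F. fst ` F 1) ` cyclic_chains m S \<subseteq> Pow {..<n}"
    proof (rule image_subsetI)
      fix F assume F: "F \<in> cyclic_chains m S"
      have "F 1 \<in> strand_matchings (S 1)" using F m by (auto simp: cyclic_chains_def)
      then show "fst ` F 1 \<in> Pow {..<n}"
        using strand_matching_bounds(1)[OF S, of 1] m closed by simp
    qed
  qed simp
  also have "\<dots> = (\<Sum>J\<in>Pow {..<n}. X ^ (n - card J) * chain_sum m S J 1 J)"
    unfolding chain_sum_def matching_chains_closed[OF m, symmetric] sum_distrib_left
    by (intro sum.cong refl) simp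
  also have "\<dots> = (\<Sum>J\<in>Pow {..<n}. X ^ (n - card J) * det (partial_rows n J id (tail_product m S 1)))"
  proof (intro sum.cong refl)
    fix J assume "J \<in> Pow {..<n}"
    then show "X ^ (n - card J) * chain_sum m S J 1 J =
        X ^ (n - card J) * det (partial_rows n J id (tail_product m S 1))"
      using det_partial_rows_tail_product[of 1 m S J id] S tops m closed
      by (simp add: n_def strict_mono_on_def)
  qed
  also have "\<dots> = det (X \<cdot>\<^sub>m 1\<^sub>m n + tail_product m S 1)"
    using tail_product_carrier[of 1 m S] tops m closed
    by (intro det_smult_one_add[symmetric]) (simp add: n_def)
  also have "tail_product m S 1 = biadjacency_product m S"
    by (simp add: tail_product_def biadjacency_product_def)
  finally show ?thesis by (simp add: P_def X_def n_def)
qed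

section \<open>Rectangular fabrics as degenerate cylinders\<close>

lemma finite_cylindrical_arcs:
  assumes "cylindrical_strands m S"
  shows "finite (arcs (cylindrical_fabric m S x))"
proof -
  have "arcs (cylindrical_fabric m S x) =
      (\<lambda>(i, e). Segment i e) ` (SIGMA i:{1..m}. segs (S i)) \<union>
      (\<lambda>(i, j). Vertical i j) ` (SIGMA i:{1..m}. {..<tops (S i)})"
    by (auto simp: cylindrical_fabric_def)
  moreover have "finite (SIGMA i:{1..m}. segs (S i))"
    using assms by (intro finite_SigmaI finite_segs) (auto simp: cylindrical_strands_def)
  ultimately show ?thesis by simp
qed

text \<open>The arcs of the two graphs differ by the edges \<open>Vertical m j\<close>, and
  \<open>Suc\<close> differs from \<open>cyclic_next m\<close> only at \<open>m\<close>, so all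
  other edges have the same ends. Weights do not affect which sets are perfect matchings, hence
  \<open>x\<close> is arbitrary.\<close>

lemma perfect_matchings_rectangular_iff:
  "M \<in> perfect_matchings (rectangular_fabric m S) \<longleftrightarrow>
    M \<in> perfect_matchings (cylindrical_fabric m S x) \<and> (\<forall>j. Vertical m j \<notin> M)"
proof -
  have arcs: "M \<subseteq> arcs (rectangular_fabric m S) \<longleftrightarrow>
      M \<subseteq> arcs (cylindrical_fabric m S x) \<and> (\<forall>j. Vertical m j \<notin> M)"
  proof -
    have "arcs (rectangular_fabric m S) = arcs (cylindrical_fabric m S x) - range (Vertical m)"
      by (auto simp: rectangular_fabric_def cylindrical_fabric_def)
    then show ?thesis by auto
  qed
  have "fabric_ends Suc e = fabric_ends (cyclic_next m) e"
    if "e \<in> M" "\<forall>j. Vertical m j \<notin> M" for e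
    using that by (cases e) (auto simp: cyclic_next_def)
  then have ends: "(e \<in> M \<and> v \<in> fabric_ends Suc e) = (e \<in> M \<and> v \<in> fabric_ends (cyclic_next m) e)"
    if "\<forall>j. Vertical m j \<notin> M" for e v
    using that by auto
  show ?thesis
  proof (cases "\<forall>j. Vertical m j \<notin> M")
    case True
    have "(\<forall>v\<in>verts (rectangular_fabric m S). \<exists>!e. e \<in> M \<and> v \<in> ends (rectangular_fabric m S) e) \<longleftrightarrow>
        (\<forall>v\<in>verts (cylindrical_fabric m S x). \<exists>!e. e \<in> M \<and> v \<in> ends (cylindrical_fabric m S x) e)"
      by (simp add: rectangular_fabric_def cylindrical_fabric_def ends[OF True])
    then show ?thesis
      unfolding perfect_matchings_def mem_Collect_eq arcs by (simp only: True simp_thms)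
  next
    case False
    then show ?thesis unfolding perfect_matchings_def mem_Collect_eq arcs
      by (simp only: False simp_thms)
  qed
qed

text \<open>A perfect matching of the cylinder that wraps around uses an edge of weight \<open>x m = 0\<close>.\<close>

lemma matching_sum_rectangular_eq_cylindrical:
  fixes S :: "nat \<Rightarrow> 'a::comm_semiring_1 strand"
  assumes cyl: "cylindrical_strands m S" and x: "\<And>i. i \<in> {1..<m} \<Longrightarrow> x i = 1" "x m = 0"
  shows "matching_sum (rectangular_fabric m S) = matching_sum (cylindrical_fabric m S x)"
proof -
  let ?R = "perfect_matchings (rectangular_fabric m S)"
  let ?C = "perfect_matchings (cylindrical_fabric m S x)"
  have sub: "M \<subseteq> arcs (cylindrical_fabric m S x)" if "M \<in> ?C" for M
    using that by (simp add: perfect_matchings_def)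
  have fin: "finite M" if "M \<in> ?C" for M
    using sub[OF that] finite_cylindrical_arcs[OF cyl] by (rule finite_subset)
  have "matching_sum (rectangular_fabric m S) = (\<Sum>M\<in>?R. \<Prod>e\<in>M. fabric_weight S (\<lambda>i. 1) e)"
    by (simp add: matching_sum_def rectangular_fabric_def)
  also have "\<dots> = (\<Sum>M\<in>?R. \<Prod>e\<in>M. fabric_weight S x e)"
  proof (intro sum.cong prod.cong refl)
    fix M e assume "M \<in> ?R" "e \<in> M"
    then have "e \<in> arcs (rectangular_fabric m S)" by (auto simp: perfect_matchings_def)
    then show "fabric_weight S (\<lambda>i. 1) e = fabric_weight S x e"
      using x by (auto simp: rectangular_fabric_def)
  qed
  also have "\<dots> = (\<Sum>M\<in>?C. \<Prod>e\<in>M. fabric_weight S x e)"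
  proof (rule sum.mono_neutral_left)
    show "finite ?C"
      using finite_cylindrical_arcs[OF cyl, of x] sub
      by (intro finite_subset[of ?C "Pow (arcs (cylindrical_fabric m S x))"]) auto
    show "?R \<subseteq> ?C" using perfect_matchings_rectangular_iff[of _ m S x] by blast
    show "\<forall>M\<in>?C - ?R. (\<Prod>e\<in>M. fabric_weight S x e) = 0"
    proof
      fix M assume M: "M \<in> ?C - ?R"
      then obtain j where "Vertical m j \<in> M"
        using perfect_matchings_rectangular_iff[of M m S x] by blast
      then have "\<exists>e\<in>M. fabric_weight S x e = 0"
        using x(2) by (intro bexI[of _ "Vertical m j"]) auto
      then show "(\<Prod>e\<in>M. fabric_weight S x e) = 0"
        using fin[of M] M by (intro prod_zero) auto
    qed
  qed
  also have "\<dots> = matching_sum (cylindrical_fabric m S x)"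
    by (simp add: matching_sum_def cylindrical_fabric_def)
  finally show ?thesis .
qed

lemma matching_sum_rectangular:
  fixes S :: "nat \<Rightarrow> 'a::field strand"
  assumes rect: "rectangular_strands m S" and bal: "balanced m S"
  shows "matching_sum (rectangular_fabric m S) = det (biadjacency_product m S)"
proof -
  \<comment> \<open>Weight 0 on the closing edges kills the multiple of the unit matrix. The
    prefactor involves only indices below \<open>m\<close>, where the weight 1 makes it trivial and
    satisfies the nonvanishing condition.\<close>
  define x :: "nat \<Rightarrow> 'a" where "x i = (if i = m then 0 else 1)" for i
  have m: "1 \<le> m" using rect by (simp add: rectangular_strands_def)
  have tops: "\<And>i. i \<in> {1..<m} \<Longrightarrow> tops (S i) = bottoms (S (Suc i))"
    using rect by (simp add: rectangular_strands_def)
  \<comment> \<open>Balance is the condition that the last strand can be joined to the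
    first.\<close>
  have cyl: "cylindrical_strands m S"
    using rect bal
    by (auto simp: rectangular_strands_def cylindrical_strands_def cyclic_next_def balanced_def)
  have zero: "(\<Prod>i\<in>{1..m}. x i) = 0" using m by (intro prod_zero) (auto simp: x_def)
  have "biadjacency_product m S \<in> carrier_mat (tops (S m)) (tops (S m))"
    using tail_product_carrier[of 1 m S] tops m bal
    by (simp add: tail_product_def biadjacency_product_def balanced_def)
  then have sum: "0 \<cdot>\<^sub>m 1\<^sub>m (tops (S m)) + biadjacency_product m S = biadjacency_product m S"
    by (intro eq_matI) auto
  have one: "(\<Prod>i\<in>{1..<m}. x i powi (int (tops (S i)) - int (tops (S m)))) = 1"
    by (intro prod.neutral) (auto simp: x_def)
  have "matching_sum (cylindrical_fabric m S x) =
      (\<Prod>i\<in>{1..<m}. x i powi (int (tops (S i)) - int (tops (S m)))) *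
      det ((\<Prod>i\<in>{1..m}. x i) \<cdot>\<^sub>m 1\<^sub>m (tops (S m)) + biadjacency_product m S)"
    by (rule matching_sum_cylindrical[OF cyl]) (simp add: x_def)
  then have "matching_sum (cylindrical_fabric m S x) = det (biadjacency_product m S)"
    unfolding zero one sum by simp
  then show ?thesis
    using matching_sum_rectangular_eq_cylindrical[OF cyl, of x] by (simp add: x_def)
qed

theorem theorem2p1:
  fixes m :: nat and S :: "nat \<Rightarrow> 'a::field strand" and x :: "nat \<Rightarrow> 'a"
  shows
    "(rectangular_strands m S \<and> balanced m S \<longrightarrow>
        matching_sum (rectangular_fabric m S) = det (biadjacency_product m S)) \<and>
     (cylindrical_strands m S \<and> (\<forall>i\<in>{1..<m}. tops (S i) < tops (S m) \<longrightarrow> x i \<noteq> 0) \<longrightarrow>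
        matching_sum (cylindrical_fabric m S x) =
          (\<Prod>i\<in>{1..<m}. x i powi (int (tops (S i)) - int (tops (S m)))) *
          det ((\<Prod>i\<in>{1..m}. x i) \<cdot>\<^sub>m 1\<^sub>m (tops (S m)) + biadjacency_product m S))"
  using matching_sum_rectangular matching_sum_cylindrical by blast

end
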